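(* Let $S$ be a discrete semigroup, let $T$ be a closed subsemigroup of $\beta S$, let $\mathcal{F}$ be a filter on $S$ such that $\overline{\mathcal{F}}=T$, and let $p\in T$. Then the following statements are equivalent: (a) $p\in K(T)$; (b) for all $A\in p$, the set $\{x\in S: x^{-1}A\in p\}$ is $\mathcal{F}$-syndetic; (c) for all $r\in T$, $p\in T\cdot r\cdot p$.
   Context: $\beta S$ is the space of ultrafilters on the discrete semigroup $S$, with basic (clopen) sets $\overline{A}=\{p\in\beta S: A\in p\}$, $A\subseteq S$. For $x\in S$, $A,G\subseteq S$ put $x^{-1}A=\{y\in S: xy\in A\}$ and $G^{-1}A=\bigcup_{x\in G}x^{-1}A$. The operation on $\beta S$ is given by: $A\in p\cdot q$ iff $\{x\in S: x^{-1}A\in q\}\in p$ (so $\beta S$ is a compact right topological semigroup). For a filter $\mathcal{F}$ on $S$, $\overline{\mathcal{F}}=\{p\in\beta S:\mathcal{F}\subseteq p\}$. A closed subsemigroup is nonempty. $K(T)$ is the smallest two-sided ideal of the compact right topological semigroup $T$. A set $A\subseteq S$ is $\mathcal{F}$-syndetic if for every $V\in\mathcal{F}$ there is a finite set $G\subseteq V$ such that $G^{-1}A\in\mathcal{F}$. *)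

theory Defs
  imports "HOL-Analysis.Abstract_Topology"
begin

text \<open>
  A filter on the semigroup is an element of the library type \<open>'a filter\<close>; \<open>members F\<close> is
  the same filter as a family of sets.  The type also contains the improper filter \<open>bot\<close>,
  the one that has the empty set as a member.
\<close>

definition members :: "'a filter \<Rightarrow> 'a set set" where
  "members F = {A. eventually (\<lambda>x. x \<in> A) F}"

definition ultrafilter :: "'a filter \<Rightarrow> bool" where
  "ultrafilter p \<longleftrightarrow> p \<noteq> bot \<and> (\<forall>A. A \<in> members p \<or> - A \<in> members p)"

definition basic_clopen :: "'a set \<Rightarrow> 'a filter set" where
  "basic_clopen A = {p. ultrafilter p \<and> A \<in> members p}"

text \<open>
  The underlying set of \<open>beta\<close> is \<open>basic_clopen UNIV\<close>, the set of all ultrafilters.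
\<close>

definition beta :: "'a filter topology" where
  "beta = topology_generated_by (range basic_clopen)"

definition left_quotient :: "'a::semigroup_mult \<Rightarrow> 'a set \<Rightarrow> 'a set" where
  "left_quotient x A = {y. x * y \<in> A}"

definition left_quotient_set :: "'a::semigroup_mult set \<Rightarrow> 'a set \<Rightarrow> 'a set" where
  "left_quotient_set G A = (\<Union>x\<in>G. left_quotient x A)"

text \<open>
  The product is defined for arbitrary filters; \<open>members_beta_mult\<close> states the usual
  description of its members.
\<close>

definition beta_mult :: "'a::semigroup_mult filter \<Rightarrow> 'a filter \<Rightarrow> 'a filter" where
  "beta_mult p q = Abs_filter (\<lambda>P. eventually (\<lambda>x. eventually (\<lambda>y. P (x * y)) q) p)"

lemma eventually_beta_mult:
  "eventually P (beta_mult p q) \<longleftrightarrow> eventually (\<lambda>x. eventually (\<lambda>y. P (x * y)) q) p"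
  unfolding beta_mult_def
proof (rule eventually_Abs_filter, rule is_filter.intro)
  fix P Q :: "'a \<Rightarrow> bool"
  assume "eventually (\<lambda>x. eventually (\<lambda>y. P (x * y)) q) p"
    and "eventually (\<lambda>x. eventually (\<lambda>y. Q (x * y)) q) p"
  then show "eventually (\<lambda>x. eventually (\<lambda>y. P (x * y) \<and> Q (x * y)) q) p"
    by eventually_elim (rule eventually_conj)
next
  fix P Q :: "'a \<Rightarrow> bool"
  assume "\<forall>x. P x \<longrightarrow> Q x" and "eventually (\<lambda>x. eventually (\<lambda>y. P (x * y)) q) p"
  then show "eventually (\<lambda>x. eventually (\<lambda>y. Q (x * y)) q) p"
    by (auto elim!: eventually_mono)
qed simp

lemma members_beta_mult:
  "A \<in> members (beta_mult p q) \<longleftrightarrow> {x. left_quotient x A \<in> members q} \<in> members p"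
  by (simp add: members_def left_quotient_def eventually_beta_mult)

lemma ultrafilter_beta_mult:
  assumes p: "ultrafilter p" and q: "ultrafilter q"
  shows "ultrafilter (beta_mult p q)"
proof -
  have neg: "eventually (\<lambda>x. \<not> P x) u" if "ultrafilter u" "\<not> eventually P u"
    for P :: "'a \<Rightarrow> bool" and u
  proof -
    have "Collect P \<in> members u \<or> - Collect P \<in> members u"
      using that(1) unfolding ultrafilter_def by blast
    then show ?thesis
      using that(2) by (simp add: members_def)
  qed
  have "A \<in> members (beta_mult p q) \<or> - A \<in> members (beta_mult p q)" for A
  proof (cases "A \<in> members (beta_mult p q)")
    case False
    then have "eventually (\<lambda>x. \<not> eventually (\<lambda>y. x * y \<in> A) q) p"
      by (intro neg[OF p]) (simp add: members_def eventually_beta_mult)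
    then have "eventually (\<lambda>x. eventually (\<lambda>y. x * y \<notin> A) q) p"
      by (rule eventually_mono) (rule neg[OF q])
    then show ?thesis
      by (simp add: members_def eventually_beta_mult)
  qed simp
  moreover have "beta_mult p q \<noteq> bot"
    using p q unfolding ultrafilter_def trivial_limit_def eventually_beta_mult
    by (simp add: trivial_limit_def)
  ultimately show ?thesis
    unfolding ultrafilter_def by blast
qed

definition closed_subsemigroup :: "'a::semigroup_mult filter set \<Rightarrow> bool" where
  "closed_subsemigroup T \<longleftrightarrow>
     T \<noteq> {} \<and> closedin beta T \<and> (\<forall>p\<in>T. \<forall>q\<in>T. beta_mult p q \<in> T)"

definition filter_hull :: "'a filter \<Rightarrow> 'a filter set" where
  "filter_hull F = {p. ultrafilter p \<and> members F \<subseteq> members p}"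

definition two_sided_ideal :: "'a::semigroup_mult filter set \<Rightarrow> 'a filter set \<Rightarrow> bool" where
  "two_sided_ideal T I \<longleftrightarrow>
     I \<noteq> {} \<and> I \<subseteq> T \<and> (\<forall>t\<in>T. \<forall>u\<in>I. beta_mult t u \<in> I \<and> beta_mult u t \<in> I)"

text \<open>
  \<open>Least\<close> is with respect to inclusion.  It denotes the smallest ideal only if there is one, which
  is a theorem for the closed subsemigroups of \<open>beta\<close>.
\<close>

definition smallest_ideal :: "'a::semigroup_mult filter set \<Rightarrow> 'a filter set" where
  "smallest_ideal T = (LEAST I. two_sided_ideal T I)"

definition syndetic :: "'a::semigroup_mult filter \<Rightarrow> 'a set \<Rightarrow> bool" where
  "syndetic F A \<longleftrightarrow>
     (\<forall>V\<in>members F. \<exists>G. finite G \<and> G \<subseteq> V \<and> left_quotient_set G A \<in> members F)"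

end

theory Submission
  imports Defs
begin

text \<open>
  Closed subsets of \<open>beta\<close> are handled through filters: the hulls of proper filters are exactly the
  nonempty closed sets, so compactness becomes the statement that every proper filter is refined by
  an ultrafilter, and Zorn's lemma is applied to filters.  If \<open>T\<close> is the hull of \<open>F\<close>, then \<open>T \<cdot> q\<close> is
  the hull of \<open>beta_mult F q\<close>.  Let \<open>K\<close> be the set of the \<open>p \<in> T\<close> with \<open>p \<in> T \<cdot> r \<cdot> p\<close> for all \<open>r \<in> T\<close>.
  An element of a minimal closed left ideal lies in \<open>K\<close>, so \<open>K\<close> is not empty; it is a two-sided
  ideal, and it lies in every two-sided ideal \<open>I\<close>, as one sees by choosing \<open>r \<in> I\<close>.  Hence \<open>K\<close> is the
  smallest ideal.  Syndeticity translates into membership in \<open>K\<close> by compactness.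
\<close>

section \<open>Zorn's lemma for filters, ultrafilters and hulls\<close>

text \<open>Zorn's lemma for the reversed order. A trivial \<open>Q\<close> will yield ultrafilters;
  a \<open>Q\<close> expressing closure under left multiplication will yield minimal closed left
  ideals.\<close>

lemma minimal_filter_exists:
  fixes F :: "'a filter"
  assumes "Q F" and "F \<noteq> bot"
    and Inf: "\<And>C. C \<noteq> {} \<Longrightarrow> (\<And>G. G \<in> C \<Longrightarrow> Q G) \<Longrightarrow> Q (Inf C)"
  obtains M where "M \<le> F" "M \<noteq> bot" "Q M" "\<And>N. N \<le> M \<Longrightarrow> N \<noteq> bot \<Longrightarrow> Q N \<Longrightarrow> N = M"
proof -
  define S where "S = {G. G \<le> F \<and> G \<noteq> bot \<and> Q G}"
  have "\<exists>M\<in>S. \<forall>N\<in>S. M \<ge> N \<longrightarrow> N = M"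
  proof (rule predicate_Zorn)
    show "partial_order_on S (relation_of (\<ge>) S)"
      by (rule partial_order_on_relation_ofI) auto
  next
    fix C assume C: "C \<in> Chains (relation_of (\<ge>) S)"
    then have sub: "C \<subseteq> S" and chain: "\<And>G H. G \<in> C \<Longrightarrow> H \<in> C \<Longrightarrow> G \<le> H \<or> H \<le> G"
      by (auto simp: Chains_def relation_of_def)
    show "\<exists>U\<in>S. \<forall>G\<in>C. G \<ge> U"
    proof (cases "C = {}")
      case True
      then show ?thesis
        using assms(1,2) by (auto simp: S_def)
    next
      case False
      then obtain G where "G \<in> C"
        by blast
      then have "Inf C \<le> F"
        using sub by (auto simp: S_def intro: Inf_lower2)
      moreover have "Inf C \<noteq> bot"
      proof -
        \<comment> \<open>Along a chain the infimum has only the members of the filters in the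
          chain, so the empty set does not enter.\<close>
        have "eventually P (Inf C) \<longleftrightarrow> (\<exists>G\<in>C. eventually P G)" for P
        proof (rule eventually_Inf_base[OF False])
          fix G H assume "G \<in> C" "H \<in> C"
          with chain[OF this] show "\<exists>x\<in>C. x \<le> inf G H"
            by (auto simp: inf.absorb1 inf.absorb2)
        qed
        then show ?thesis
          using sub by (auto simp: S_def trivial_limit_def)
      qed
      moreover have "Q (Inf C)"
        using False sub by (intro Inf) (auto simp: S_def)
      ultimately show ?thesis
        by (auto simp: S_def intro: Inf_lower)
    qed
  qed
  then show thesis
    using that by (auto simp: S_def)
qed

lemma filter_le_iff_members: "p \<le> F \<longleftrightarrow> members F \<subseteq> members p"
proof -
  have "p \<le> F" if "members F \<subseteq> members p"
  proof (rule filter_leI)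
    fix P assume "eventually P F"
    then have "Collect P \<in> members F"
      by (simp add: members_def)
    from subsetD[OF that this] show "eventually P p"
      by (simp add: members_def)
  qed
  then show ?thesis
    by (auto simp: members_def intro: filter_leD)
qed

lemma filter_hull_iff: "p \<in> filter_hull F \<longleftrightarrow> ultrafilter p \<and> p \<le> F"
  by (simp add: filter_hull_def filter_le_iff_members)

lemma Compl_in_members_iff: "ultrafilter p \<Longrightarrow> - A \<in> members p \<longleftrightarrow> A \<notin> members p"
  unfolding ultrafilter_def members_def trivial_limit_def
  by (auto dest: eventually_conj)

text \<open>Complements turn the finite union into a finite intersection, which every filter
  respects.\<close>

lemma Union_in_members_iff:
  assumes "ultrafilter p" and "finite I"
  shows "(\<Union>i\<in>I. A i) \<in> members p \<longleftrightarrow> (\<exists>i\<in>I. A i \<in> members p)"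
proof -
  have "- (\<Union>i\<in>I. A i) \<in> members p \<longleftrightarrow> (\<forall>i\<in>I. - A i \<in> members p)"
    using assms(2) by (simp add: members_def eventually_ball_finite_distrib)
  then show ?thesis
    using Compl_in_members_iff[OF assms(1)] by blast
qed

lemma ultrafilter_below:
  assumes "F \<noteq> bot"
  obtains p where "ultrafilter p" "p \<le> F"
proof -
  obtain p where p: "p \<le> F" "p \<noteq> bot" and min: "\<And>N. N \<le> p \<Longrightarrow> N \<noteq> bot \<Longrightarrow> N = p"
    using minimal_filter_exists[of "\<lambda>_. True", OF TrueI assms TrueI] by metis
  \<comment> \<open>Adjoining \<open>A\<close> to \<open>p\<close> either gives the improper filter,
    so that \<open>- A\<close> is already a member, or, by minimality, gives nothing new.\<close>
  have "A \<in> members p \<or> - A \<in> members p" for A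
  proof (cases "inf p (principal A) = bot")
    case True
    then show ?thesis
      by (auto simp: trivial_limit_def eventually_inf_principal members_def)
  next
    case False
    then have "inf p (principal A) = p"
      by (intro min) auto
    then have "p \<le> principal A"
      by (simp add: inf.absorb_iff1)
    then show ?thesis
      by (simp add: le_principal members_def)
  qed
  with p show thesis
    using that by (auto simp: ultrafilter_def)
qed

text \<open>A filter is determined by the ultrafilters refining it: if a member of \<open>G\<close>
  is missing from \<open>H\<close>, its complement is compatible with \<open>H\<close>, and an
  ultrafilter refining both separates the hulls.\<close>

lemma filter_hull_mono_iff: "filter_hull H \<subseteq> filter_hull G \<longleftrightarrow> H \<le> G"
proof
  assume sub: "filter_hull H \<subseteq> filter_hull G"
  show "H \<le> G"
  proof (rule filter_leI, rule ccontr)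
    fix P assume P: "eventually P G" and "\<not> eventually P H"
    then have "inf H (principal (- Collect P)) \<noteq> bot"
      by (simp add: trivial_limit_def eventually_inf_principal)
    then obtain p where p: "ultrafilter p" "p \<le> H" "p \<le> principal (- Collect P)"
      by (metis ultrafilter_below le_inf_iff)
    then have "p \<le> G"
      using sub by (auto simp: filter_hull_iff)
    then have "Collect P \<in> members p"
      using P by (auto simp: members_def intro: filter_leD)
    then show False
      using p Compl_in_members_iff[of p "Collect P"] by (simp add: members_def le_principal)
  qed
qed (auto simp: filter_hull_iff intro: order_trans)

section \<open>Products and hulls\<close>

lemma beta_mult_assoc: "beta_mult (beta_mult p q) r = beta_mult p (beta_mult q r)"
  by (simp add: filter_eq_iff eventually_beta_mult mult.assoc)

lemma beta_mult_mono: "p \<le> F \<Longrightarrow> beta_mult p q \<le> beta_mult F q"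
  by (auto simp: le_filter_def eventually_beta_mult)

text \<open>The filter form of the fact that right translation by \<open>q\<close> is continuous and
  so carries compact sets to compact sets.\<close>

lemma filter_hull_beta_mult:
  fixes F q :: "'a::semigroup_mult filter"
  assumes "ultrafilter q"
  shows "filter_hull (beta_mult F q) = {beta_mult t q | t. t \<in> filter_hull F}"
proof (intro equalityI subsetI)
  fix w assume "w \<in> filter_hull (beta_mult F q)"
  then have w: "ultrafilter w" "w \<le> beta_mult F q"
    by (auto simp: filter_hull_iff)
  define B where "B A = {x. left_quotient x A \<in> members q}" for A
  \<comment> \<open>Any \<open>t\<close> with \<open>w = beta_mult t q\<close> must contain every
    \<open>B A\<close> with \<open>A\<close> in \<open>w\<close>; these sets form a base of
    \<open>H\<close>.\<close>
  define H where "H = (INF A\<in>members w. principal (B A))"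
  have ev_H: "eventually P H \<longleftrightarrow> (\<exists>A\<in>members w. \<forall>x\<in>B A. P x)" for P
    unfolding H_def
  proof (subst eventually_INF_base)
    have "UNIV \<in> members w"
      by (simp add: members_def)
    then show "members w \<noteq> {}"
      by blast
    fix A A' assume "A \<in> members w" "A' \<in> members w"
    then have "A \<inter> A' \<in> members w" "B (A \<inter> A') \<subseteq> B A \<inter> B A'"
      by (auto simp: members_def B_def left_quotient_def elim: eventually_mono intro: eventually_conj)
    then show "\<exists>D\<in>members w. principal (B D) \<le> inf (principal (B A)) (principal (B A'))"
      by auto
  qed (simp add: eventually_principal)
  have "inf F H \<noteq> bot"
  proof
    assume "inf F H = bot"
    then have "eventually (\<lambda>_. False) (inf F H)"
      by simp
    then obtain P Q where "eventually P F" "eventually Q H" and PQ: "\<And>x. \<not> (P x \<and> Q x)"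
      by (auto simp: eventually_inf)
    then obtain A where A: "A \<in> members w" and "\<forall>x\<in>B A. Q x"
      by (auto simp: ev_H)
    \<comment> \<open>If \<open>F\<close> avoids \<open>B A\<close>, then \<open>- A\<close> belongs
      to \<open>beta_mult F q\<close>, hence to \<open>w\<close>, which already contains
      \<open>A\<close>.\<close>
    have "eventually (\<lambda>x. x \<notin> B A) F"
      using \<open>eventually P F\<close> by (rule eventually_mono) (use PQ \<open>\<forall>x\<in>B A. Q x\<close> in blast)
    moreover have "x \<notin> B A \<Longrightarrow> left_quotient x (- A) \<in> members q" for x
      using Compl_in_members_iff[OF assms, of "left_quotient x A"]
      by (simp add: B_def left_quotient_def Collect_neg_eq[symmetric])
    ultimately have "eventually (\<lambda>x. left_quotient x (- A) \<in> members q) F"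
      by (auto elim: eventually_mono)
    then have "- A \<in> members (beta_mult F q)"
      by (simp add: members_beta_mult) (simp add: members_def)
    then show False
      using w A by (auto simp: filter_le_iff_members Compl_in_members_iff)
  qed
  then obtain t where t: "ultrafilter t" "t \<le> F" "t \<le> H"
    by (metis ultrafilter_below le_inf_iff)
  have w_sub: "A \<in> members (beta_mult t q)" if "A \<in> members w" for A
  proof -
    have "eventually (\<lambda>x. x \<in> B A) t"
      using that by (intro filter_leD[OF t(3)]) (auto simp: ev_H)
    then show ?thesis
      by (simp add: members_beta_mult B_def) (simp add: members_def)
  qed
  \<comment> \<open>Between ultrafilters, inclusion of members is already equality.\<close>
  have "members (beta_mult t q) = members w"
    using w_sub w(1) ultrafilter_beta_mult[OF t(1) assms] Compl_in_members_iff by blast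
  then have "w = beta_mult t q"
    by (intro antisym) (auto simp: filter_le_iff_members)
  with t show "w \<in> {beta_mult t q | t. t \<in> filter_hull F}"
    by (auto simp: filter_hull_iff)
next
  fix w assume "w \<in> {beta_mult t q | t. t \<in> filter_hull F}"
  then show "w \<in> filter_hull (beta_mult F q)"
    using assms by (auto simp: filter_hull_iff intro: ultrafilter_beta_mult beta_mult_mono)
qed

section \<open>Minimal left ideals and the smallest ideal\<close>

text \<open>The point \<open>u\<close> comes from a minimal closed left ideal. As T \<cdot> r
  \<cdot> u is a closed left ideal inside it, the two agree, and T \<cdot> r \<cdot> u contains
  \<open>u\<close>.\<close>

lemma exists_minimal_element:
  assumes T: "closed_subsemigroup T" and F: "filter_hull F = T"
  shows "\<exists>u\<in>T. \<forall>r\<in>T. u \<in> {beta_mult (beta_mult t r) u | t. t \<in> T}"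
proof -
  \<comment> \<open>For proper \<open>G\<close>, this says that the hull of \<open>G\<close> is a
    closed left ideal of \<open>T\<close>.\<close>
  define Q where "Q G \<longleftrightarrow> G \<le> F \<and> (\<forall>t\<in>T. \<forall>u\<in>filter_hull G. beta_mult t u \<in> filter_hull G)" for G
  have T_mult: "\<And>s t. s \<in> T \<Longrightarrow> t \<in> T \<Longrightarrow> beta_mult s t \<in> T"
    using T by (simp add: closed_subsemigroup_def)
  have T_ultra: "\<And>t. t \<in> T \<Longrightarrow> ultrafilter t"
    using F by (auto simp: filter_hull_iff)
  have QF: "Q F"
    using F T_mult by (simp add: Q_def)
  have F_proper: "F \<noteq> bot"
    using T F unfolding closed_subsemigroup_def
    by (auto simp: filter_hull_iff ultrafilter_def bot_unique)
  have Q_Inf: "Q (Inf C)" if "C \<noteq> {}" "\<And>G. G \<in> C \<Longrightarrow> Q G" for C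
    using that unfolding Q_def
    by (auto simp: filter_hull_iff le_Inf_iff intro: Inf_lower2)
  obtain M where "M \<noteq> bot" "Q M"
    and min: "\<And>N. N \<le> M \<Longrightarrow> N \<noteq> bot \<Longrightarrow> Q N \<Longrightarrow> N = M"
    using minimal_filter_exists[of Q, OF QF F_proper Q_Inf] by metis
  then obtain u where u: "u \<in> filter_hull M"
    by (metis ultrafilter_below filter_hull_iff)
  then have "u \<in> T"
    using \<open>Q M\<close> F by (auto simp: Q_def filter_hull_iff)
  moreover have "u \<in> {beta_mult (beta_mult t r) u | t. t \<in> T}" if "r \<in> T" for r
  proof -
    let ?q = "beta_mult r u"
    have hull: "filter_hull (beta_mult F ?q) = {beta_mult t ?q | t. t \<in> T}"
      using filter_hull_beta_mult[of ?q F] F T_ultra T_mult \<open>r \<in> T\<close> \<open>u \<in> T\<close> by auto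
    have "?q \<in> filter_hull M"
      using \<open>Q M\<close> u \<open>r \<in> T\<close> by (auto simp: Q_def)
    then have le: "beta_mult F ?q \<le> M"
      using \<open>Q M\<close> hull by (auto simp: Q_def simp flip: filter_hull_mono_iff)
    have "beta_mult F ?q = M"
    proof (rule min[OF le])
      have "beta_mult r ?q \<in> filter_hull (beta_mult F ?q)"
        using hull \<open>r \<in> T\<close> by auto
      then show "beta_mult F ?q \<noteq> bot"
        by (auto simp: filter_hull_iff ultrafilter_def bot_unique)
      show "Q (beta_mult F ?q)"
        using le \<open>Q M\<close> hull T_mult by (fastforce simp: Q_def simp flip: beta_mult_assoc)
    qed
    then show ?thesis
      using u hull by (simp add: beta_mult_assoc)
  qed
  ultimately show ?thesis
    by blast
qed

lemma smallest_ideal_eq: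
  assumes T: "closed_subsemigroup T" and F: "filter_hull F = T"
  shows "smallest_ideal T = {p \<in> T. \<forall>r\<in>T. p \<in> {beta_mult (beta_mult t r) p | t. t \<in> T}}"
    (is "_ = ?K")
  unfolding smallest_ideal_def
proof (rule Least_equality)
  have T_mult: "\<And>s t. s \<in> T \<Longrightarrow> t \<in> T \<Longrightarrow> beta_mult s t \<in> T"
    using T by (simp add: closed_subsemigroup_def)
  have "beta_mult s u \<in> ?K \<and> beta_mult u s \<in> ?K" if s: "s \<in> T" and u: "u \<in> ?K" for s u
  proof -
    have "(\<exists>t\<in>T. beta_mult s u = beta_mult (beta_mult t r) (beta_mult s u))
        \<and> (\<exists>t\<in>T. beta_mult u s = beta_mult (beta_mult t r) (beta_mult u s))" if r: "r \<in> T" for r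
    proof -
      \<comment> \<open>The property of \<open>u\<close> is applied to r \<cdot> s, so that left
        multiplication by \<open>s\<close> gives the factor s \<cdot> t for s \<cdot> u. Right
        multiplication by \<open>s\<close> keeps the factor \<open>t'\<close> unchanged.\<close>
      obtain t where t: "t \<in> T" "u = beta_mult (beta_mult t (beta_mult r s)) u"
        using u T_mult[OF r s] by blast
      obtain t' where t': "t' \<in> T" "u = beta_mult (beta_mult t' r) u"
        using u r by blast
      have "beta_mult s u = beta_mult (beta_mult (beta_mult s t) r) (beta_mult s u)"
        by (subst t(2)) (simp add: beta_mult_assoc)
      moreover have "beta_mult u s = beta_mult (beta_mult t' r) (beta_mult u s)"
        by (subst t'(2)) (simp add: beta_mult_assoc)
      ultimately show ?thesis
        using T_mult[OF s t(1)] t'(1) by blast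
    qed
    then show ?thesis
      using T_mult s u by blast
  qed
  moreover have "?K \<noteq> {}"
    using exists_minimal_element[OF assms] by auto
  ultimately show "two_sided_ideal T ?K"
    unfolding two_sided_ideal_def by blast
next
  fix I assume I: "two_sided_ideal T I"
  then obtain r where r: "r \<in> I" "r \<in> T"
    unfolding two_sided_ideal_def by blast
  show "?K \<subseteq> I"
  proof
    fix p assume p: "p \<in> ?K"
    then obtain t where "t \<in> T" "p = beta_mult (beta_mult t r) p"
      using r by blast
    moreover have "beta_mult (beta_mult t r) p \<in> I"
      using I r p \<open>t \<in> T\<close> unfolding two_sided_ideal_def by blast
    ultimately show "p \<in> I"
      by simp
  qed
qed

section \<open>Syndetic return sets\<close>

lemma left_quotient_return_set:
  "left_quotient x {z. left_quotient z A \<in> members p} = {y. left_quotient y (left_quotient x A) \<in> members p}"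
  by (simp add: left_quotient_def mult.assoc)

text \<open>The bridge between quotients of the return set of \<open>p\<close>, as they occur in
  syndeticity, and the product of \<open>r\<close> and \<open>p\<close>.\<close>

lemma left_quotient_return_set_members:
  "left_quotient x {z. left_quotient z A \<in> members p} \<in> members r \<longleftrightarrow>
     left_quotient x A \<in> members (beta_mult r p)"
  by (simp add: left_quotient_return_set members_beta_mult)

lemma members_syndetic_imp_le:
  assumes p: "ultrafilter p" and r: "ultrafilter r" "r \<le> F"
    and synd: "\<And>A. A \<in> members p \<Longrightarrow> syndetic F {x. left_quotient x A \<in> members p}"
  shows "p \<le> beta_mult F (beta_mult r p)"
  unfolding filter_le_iff_members
proof (rule subsetI, rule ccontr)
  fix D assume D: "D \<in> members (beta_mult F (beta_mult r p))" and "D \<notin> members p"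
  then have "- D \<in> members p"
    using p by (simp add: Compl_in_members_iff)
  \<comment> \<open>Syndeticity for \<open>- D\<close> is used with \<open>V\<close> the set of all
    \<open>x\<close> whose quotient of \<open>D\<close> lies in r \<cdot> p; this \<open>V\<close>
    is in \<open>F\<close> because of \<open>D\<close>. Some \<open>x\<close> in \<open>G\<close>
    will then put the quotient of \<open>- D\<close> into r \<cdot> p as well.\<close>
  from synd[OF this] D obtain G where "finite G"
    and G: "G \<subseteq> {x. left_quotient x D \<in> members (beta_mult r p)}"
    and "left_quotient_set G {x. left_quotient x (- D) \<in> members p} \<in> members F"
    unfolding syndetic_def members_beta_mult[of _ F] by blast
  then have "left_quotient_set G {x. left_quotient x (- D) \<in> members p} \<in> members r"
    using r(2) by (auto simp: filter_le_iff_members)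
  then obtain x where "x \<in> G" "left_quotient x (- D) \<in> members (beta_mult r p)"
    using Union_in_members_iff[OF r(1) \<open>finite G\<close>]
    by (auto simp: left_quotient_set_def left_quotient_return_set_members)
  moreover have "left_quotient x (- D) = - left_quotient x D"
    by (auto simp: left_quotient_def)
  ultimately show False
    using G Compl_in_members_iff[OF ultrafilter_beta_mult[OF r(1) p]] by auto
qed

text \<open>Compactness: if no finite subset of \<open>V\<close> covers a member of \<open>F\<close>
  by quotients of \<open>B\<close>, then the complements of all these quotients are jointly
  compatible with \<open>F\<close>.\<close>

lemma not_syndetic_witness:
  assumes "\<not> syndetic F B"
  obtains V r where "V \<in> members F" "ultrafilter r" "r \<le> F"
    "\<And>x. x \<in> V \<Longrightarrow> left_quotient x B \<notin> members r"
proof -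
  obtain V where V: "V \<in> members F"
    and none: "\<And>G. finite G \<Longrightarrow> G \<subseteq> V \<Longrightarrow> left_quotient_set G B \<notin> members F"
    using assms by (auto simp: syndetic_def)
  define H where "H = (INF x\<in>V. principal (- left_quotient x B))"
  have "inf F H \<noteq> bot"
  proof
    assume "inf F H = bot"
    then have "eventually (\<lambda>_. False) (inf F H)"
      by simp
    then obtain P Q where P: "eventually P F" and "eventually Q H" and PQ: "\<And>x. \<not> (P x \<and> Q x)"
      by (auto simp: eventually_inf)
    then obtain G where G: "G \<subseteq> V" "finite G"
      and "eventually Q (INF x\<in>G. principal (- left_quotient x B))"
      unfolding H_def eventually_INF[of _ _ V] by blast
    then have "\<forall>y. (\<forall>x\<in>G. y \<notin> left_quotient x B) \<longrightarrow> Q y"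
      by (simp add: INF_principal_finite eventually_principal)
    with PQ have "\<And>y. P y \<Longrightarrow> y \<in> left_quotient_set G B"
      by (auto simp: left_quotient_set_def)
    then have "left_quotient_set G B \<in> members F"
      unfolding members_def using P by (auto elim: eventually_mono)
    then show False
      using none G by blast
  qed
  then obtain r where r: "ultrafilter r" "r \<le> F" "r \<le> H"
    by (metis ultrafilter_below le_inf_iff)
  have "left_quotient x B \<notin> members r" if "x \<in> V" for x
  proof -
    have "r \<le> principal (- left_quotient x B)"
      using that r(3) unfolding H_def by (auto simp: le_INF_iff)
    then have "- left_quotient x B \<in> members r"
      by (simp add: le_principal members_def)
    then show ?thesis
      using r(1) by (simp add: Compl_in_members_iff)
  qed
  with V r that show thesis
    by blast
qed

theorem theorem2p8:
  fixes T :: "'a::semigroup_mult filter set" and F p :: "'a filter"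
  assumes "closed_subsemigroup T"
    and "filter_hull F = T"
    and "p \<in> T"
  shows "(p \<in> smallest_ideal T \<longleftrightarrow>
            (\<forall>A\<in>members p. syndetic F {x. left_quotient x A \<in> members p}))
       \<and> ((\<forall>A\<in>members p. syndetic F {x. left_quotient x A \<in> members p}) \<longleftrightarrow>
            (\<forall>r\<in>T. p \<in> {beta_mult (beta_mult t r) p | t. t \<in> T}))"
    (is "(_ \<longleftrightarrow> ?b) \<and> (_ \<longleftrightarrow> ?c)")
proof -
  have ultra: "\<And>t. t \<in> T \<Longrightarrow> ultrafilter t \<and> t \<le> F"
    using assms(2) by (auto simp: filter_hull_iff)
  have ac: "p \<in> smallest_ideal T \<longleftrightarrow> ?c"
    using smallest_ideal_eq[OF assms(1,2)] assms(3) by auto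
  have bc: ?c if ?b
  proof
    fix r assume "r \<in> T"
    then have "ultrafilter (beta_mult r p)"
      using ultra assms(3) by (simp add: ultrafilter_beta_mult)
    \<comment> \<open>This hull is T \<cdot> r \<cdot> p by \<open>filter_hull_beta_mult\<close>, so
      an inequality of filters suffices.\<close>
    moreover have "p \<in> filter_hull (beta_mult F (beta_mult r p))"
      using \<open>r \<in> T\<close> members_syndetic_imp_le[of p r F] ultra assms(3) that by (auto simp: filter_hull_iff)
    ultimately show "p \<in> {beta_mult (beta_mult t r) p | t. t \<in> T}"
      using assms(2) by (simp add: filter_hull_beta_mult beta_mult_assoc)
  qed
  have cb: ?b if ?c
  proof (rule ballI, rule ccontr)
    fix A assume A: "A \<in> members p" and "\<not> syndetic F {x. left_quotient x A \<in> members p}"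
    then obtain V r where V: "V \<in> members F" and r: "ultrafilter r" "r \<le> F"
      and avoid: "\<And>x. x \<in> V \<Longrightarrow> left_quotient x A \<notin> members (beta_mult r p)"
      using not_syndetic_witness by (metis left_quotient_return_set_members)
    then have "r \<in> T"
      by (simp add: filter_hull_iff flip: assms(2))
    with \<open>?c\<close> obtain t where t: "t \<in> T" "p = beta_mult (beta_mult t r) p"
      by blast
    then have "A \<in> members (beta_mult t (beta_mult r p))"
      using A by (simp flip: beta_mult_assoc)
    then have "{x. left_quotient x A \<in> members (beta_mult r p)} \<in> members t"
      by (simp add: members_beta_mult[of _ t])
    \<comment> \<open>Since \<open>t\<close> refines \<open>F\<close>, it contains \<open>V\<close>;
      but no \<open>x\<close> in \<open>V\<close> belongs to the set just shown to be in
      \<open>t\<close>.\<close>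
    moreover have "V \<in> members t"
      using V ultra[OF t(1)] by (auto simp: filter_le_iff_members)
    ultimately have "eventually (\<lambda>x. False) t"
      using avoid unfolding members_def by (auto elim: eventually_elim2)
    then show False
      using ultra[OF t(1)] by (simp add: ultrafilter_def trivial_limit_def)
  qed
  show ?thesis
    using ac bc cb by blast
qed

end
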